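(* Let $K$ be a simplicial complex on $m$ vertices, with vertex set $[m]=\{1,\dots,m\}$, and let $N(K)$ be the set of its minimal non-simplices. Then: 1. $s(K)=0$ if and only if $N(K)=\varnothing$ (equivalently, $K=\Delta^n$ is a simplex, i.e. $K$ consists of all subsets of $[m]$). 2. $s(K)=1$ if and only if any two and any three subsets in $N(K)$ intersect (that is, any two distinct sets in $N(K)$ have nonempty intersection, and any three distinct sets in $N(K)$ have nonempty common intersection). 3. $s(K)=2$ if and only if some two or three subsets in $N(K)$ do not intersect (that is, there are two distinct sets in $N(K)$ with empty intersection or three distinct sets in $N(K)$ with empty common intersection), and $N(K)$ does not contain any subset of one of the following five forms (in each form the listed elements $\tau_i$ are pairwise distinct): (i) $\{\tau_1,\dots,\tau_7\}$ with $\tau_1\cap\tau_2\cap\tau_4=\varnothing$, $\tau_1\cap\tau_3\cap\tau_5=\varnothing$, $\tau_1\cap\tau_6\cap\tau_7=\varnothing$, $\tau_2\cap\tau_3\cap\tau_6=\varnothing$, $\tau_2\cap\tau_5\cap\tau_7=\varnothing$, $\tau_3\cap\tau_4\cap\tau_7=\varnothing$, $\tau_4\cap\tau_5\cap\tau_6=\varnothing$; (ii) $\{\tau_1,\dots,\tau_6\}$ with $\tau_1\cap\tau_3=\varnothing$, $\tau_1\cap\tau_2\cap\tau_4=\varnothing$, $\tau_1\cap\tau_2\cap\tau_5=\varnothing$, $\tau_1\cap\tau_4\cap\tau_6=\varnothing$, $\tau_1\cap\tau_5\cap\tau_6=\varnothing$, $\tau_2\cap\tau_3\cap\tau_6=\varnothing$,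 $\tau_3\cap\tau_4\cap\tau_5=\varnothing$; (iii) $\{\tau_1,\dots,\tau_5\}$ with $\tau_1\cap\tau_2=\varnothing$, $\tau_1\cap\tau_5=\varnothing$, $\tau_1\cap\tau_3\cap\tau_4=\varnothing$, $\tau_2\cap\tau_3\cap\tau_5=\varnothing$, $\tau_2\cap\tau_4\cap\tau_5=\varnothing$; (iv) $\{\tau_1,\dots,\tau_4\}$ with $\tau_1\cap(\tau_2\cup\tau_3\cup\tau_4)=\varnothing$ and $\tau_2\cap\tau_3\cap\tau_4=\varnothing$; (v) $\{\tau_1,\tau_2,\tau_3\}$ with $\tau_1\cap\tau_2=\tau_1\cap\tau_3=\tau_2\cap\tau_3=\varnothing$.
   Context: A simplicial complex $K$ on $[m]=\{1,\dots,m\}$ is a nonempty family of subsets of $[m]$ (called simplices) closed under taking subsets; in particular $\varnothing\in K$. A non-simplex is a set $\omega\subseteq[m]$ with $\omega\notin K$; it is minimal if every proper subset of $\omega$ belongs to $K$. $N(K)$ denotes the set of all minimal non-simplices of $K$. Let $D^2=\{z\in\mathbb C: |z|\leqslant 1\}$ and $S^1=\{z\in\mathbb C: |z|=1\}$. The moment-angle complex is $\mathcal Z_K=\{(x_1,\dots,x_m)\in (D^2)^m: \{i: x_i\notin S^1\}\in K\}$. The torus $T^m=(S^1)^m$ acts on $\mathcal Z_K$ by coordinatewise multiplication. The Buchstaber invariant $s(K)$ is the maximal dimension $s$ of a toric subgroup $H\subset T^m$, $H\simeq T^s$ (a closed subgroup isomorphic to a torus of dimension $s$), that acts freely on $\mathcal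 Z_K$.
   Formalization: In item 2 the right-hand side also requires N(K) to be nonempty: for K the full simplex, N(K) is empty and the intersection condition holds vacuously while s(K)=0, so item 2 read literally contradicts item 1. *)

theory Defs
  imports "HOL-Analysis.Analysis" "HOL-Algebra.Product_Groups"
begin

(* Ghost vertices are allowed: a singleton {i} with i in {1..m} need not belong to K. *)
definition abstract_simplicial_complex :: "nat \<Rightarrow> nat set set \<Rightarrow> bool" where
  "abstract_simplicial_complex m K \<longleftrightarrow>
     K \<noteq> {} \<and> K \<subseteq> Pow {1..m} \<and> (\<forall>\<sigma>\<in>K. \<forall>\<tau>. \<tau> \<subseteq> \<sigma> \<longrightarrow> \<tau> \<in> K)"

definition min_nonsimplices :: "nat \<Rightarrow> nat set set \<Rightarrow> nat set set" where
  "min_nonsimplices m K = {\<omega>. \<omega> \<subseteq> {1..m} \<and> \<omega> \<notin> K \<and> (\<forall>\<tau>. \<tau> \<subset> \<omega> \<longrightarrow> \<tau> \<in> K)}"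

definition circle_group :: "complex monoid" where
  "circle_group = \<lparr>carrier = sphere 0 1, mult = (*), one = 1\<rparr>"

(* An m-tuple is a function in PiE {1..m} _, i.e. one that is undefined outside {1..m}. *)
definition torus :: "nat \<Rightarrow> (nat \<Rightarrow> complex) monoid" where
  "torus m = product_group {1..m} (\<lambda>_. circle_group)"

definition torus_topology :: "nat \<Rightarrow> (nat \<Rightarrow> complex) topology" where
  "torus_topology m = product_topology (\<lambda>_. top_of_set (sphere 0 1)) {1..m}"

definition moment_angle_complex :: "nat \<Rightarrow> nat set set \<Rightarrow> (nat \<Rightarrow> complex) set" where
  "moment_angle_complex m K =
     {x \<in> {1..m} \<rightarrow>\<^sub>E cball 0 1. {i \<in> {1..m}. x i \<notin> sphere 0 1} \<in> K}"

definition torus_act :: "nat \<Rightarrow> (nat \<Rightarrow> complex) \<Rightarrow> (nat \<Rightarrow> complex) \<Rightarrow> nat \<Rightarrow> complex" where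
  "torus_act m t x = (\<lambda>i\<in>{1..m}. t i * x i)"

(* A single map f is both the group isomorphism and the homeomorphism,
   so H is isomorphic to the s-torus as a topological group. *)
definition toric_subgroup :: "nat \<Rightarrow> nat \<Rightarrow> (nat \<Rightarrow> complex) set \<Rightarrow> bool" where
  "toric_subgroup m s H \<longleftrightarrow>
     subgroup H (torus m) \<and> closedin (torus_topology m) H \<and>
     (\<exists>f. f \<in> iso (torus s) (torus m\<lparr>carrier := H\<rparr>) \<and>
          homeomorphic_map (torus_topology s) (subtopology (torus_topology m) H) f)"

definition acts_freely :: "nat \<Rightarrow> (nat \<Rightarrow> complex) set \<Rightarrow> (nat \<Rightarrow> complex) set \<Rightarrow> bool" where
  "acts_freely m H X \<longleftrightarrow> (\<forall>h\<in>H. \<forall>x\<in>X. torus_act m h x = x \<longrightarrow> h = \<one>\<^bsub>torus m\<^esub>)"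

(* The maximum is over a nonempty finite set: the trivial subgroup gives s = 0, and s \<le> m since
   the s-torus has 2 ^ s elements whose square is the identity. *)
definition buchstaber_invariant :: "nat \<Rightarrow> nat set set \<Rightarrow> nat" where
  "buchstaber_invariant m K =
     Max {s. \<exists>H. toric_subgroup m s H \<and> acts_freely m H (moment_angle_complex m K)}"

definition form_i :: "nat set set \<Rightarrow> bool" where
  "form_i A \<longleftrightarrow> (\<exists>\<tau>1 \<tau>2 \<tau>3 \<tau>4 \<tau>5 \<tau>6 \<tau>7.
     A = {\<tau>1, \<tau>2, \<tau>3, \<tau>4, \<tau>5, \<tau>6, \<tau>7} \<and> distinct [\<tau>1, \<tau>2, \<tau>3, \<tau>4, \<tau>5, \<tau>6, \<tau>7] \<and>
     \<tau>1 \<inter> \<tau>2 \<inter> \<tau>4 = {} \<and> \<tau>1 \<inter> \<tau>3 \<inter> \<tau>5 = {} \<and> \<tau>1 \<inter> \<tau>6 \<inter> \<tau>7 = {} \<and>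
     \<tau>2 \<inter> \<tau>3 \<inter> \<tau>6 = {} \<and> \<tau>2 \<inter> \<tau>5 \<inter> \<tau>7 = {} \<and> \<tau>3 \<inter> \<tau>4 \<inter> \<tau>7 = {} \<and>
     \<tau>4 \<inter> \<tau>5 \<inter> \<tau>6 = {})"

definition form_ii :: "nat set set \<Rightarrow> bool" where
  "form_ii A \<longleftrightarrow> (\<exists>\<tau>1 \<tau>2 \<tau>3 \<tau>4 \<tau>5 \<tau>6.
     A = {\<tau>1, \<tau>2, \<tau>3, \<tau>4, \<tau>5, \<tau>6} \<and> distinct [\<tau>1, \<tau>2, \<tau>3, \<tau>4, \<tau>5, \<tau>6] \<and>
     \<tau>1 \<inter> \<tau>3 = {} \<and> \<tau>1 \<inter> \<tau>2 \<inter> \<tau>4 = {} \<and> \<tau>1 \<inter> \<tau>2 \<inter> \<tau>5 = {} \<and>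
     \<tau>1 \<inter> \<tau>4 \<inter> \<tau>6 = {} \<and> \<tau>1 \<inter> \<tau>5 \<inter> \<tau>6 = {} \<and> \<tau>2 \<inter> \<tau>3 \<inter> \<tau>6 = {} \<and>
     \<tau>3 \<inter> \<tau>4 \<inter> \<tau>5 = {})"

definition form_iii :: "nat set set \<Rightarrow> bool" where
  "form_iii A \<longleftrightarrow> (\<exists>\<tau>1 \<tau>2 \<tau>3 \<tau>4 \<tau>5.
     A = {\<tau>1, \<tau>2, \<tau>3, \<tau>4, \<tau>5} \<and> distinct [\<tau>1, \<tau>2, \<tau>3, \<tau>4, \<tau>5] \<and>
     \<tau>1 \<inter> \<tau>2 = {} \<and> \<tau>1 \<inter> \<tau>5 = {} \<and> \<tau>1 \<inter> \<tau>3 \<inter> \<tau>4 = {} \<and>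
     \<tau>2 \<inter> \<tau>3 \<inter> \<tau>5 = {} \<and> \<tau>2 \<inter> \<tau>4 \<inter> \<tau>5 = {})"

definition form_iv :: "nat set set \<Rightarrow> bool" where
  "form_iv A \<longleftrightarrow> (\<exists>\<tau>1 \<tau>2 \<tau>3 \<tau>4.
     A = {\<tau>1, \<tau>2, \<tau>3, \<tau>4} \<and> distinct [\<tau>1, \<tau>2, \<tau>3, \<tau>4] \<and>
     \<tau>1 \<inter> (\<tau>2 \<union> \<tau>3 \<union> \<tau>4) = {} \<and> \<tau>2 \<inter> \<tau>3 \<inter> \<tau>4 = {})"

definition form_v :: "nat set set \<Rightarrow> bool" where
  "form_v A \<longleftrightarrow> (\<exists>\<tau>1 \<tau>2 \<tau>3.
     A = {\<tau>1, \<tau>2, \<tau>3} \<and> distinct [\<tau>1, \<tau>2, \<tau>3] \<and>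
     \<tau>1 \<inter> \<tau>2 = {} \<and> \<tau>1 \<inter> \<tau>3 = {} \<and> \<tau>2 \<inter> \<tau>3 = {})"

end

theory Submission
  imports Defs
begin

text \<open>
  The \<open>s\<close>-torus is filled with elements of order two: for \<open>S \<subseteq> {1..s}\<close> take the element with entries
  \<open>-1\<close> on \<open>S\<close> and \<open>1\<close> elsewhere.  If \<open>T^s\<close> embeds into \<open>T^m\<close> and acts freely, the image of this element is a
  vector of signs, and freeness says that the positions of its signs \<open>-1\<close> do not form a simplex when
  \<open>S \<noteq> {}\<close>.  So these positions contain a minimal non-simplex \<open>w S\<close>.  Signs multiply, hence at no
  position do the elements of \<open>S\<close>, \<open>T\<close> and their symmetric difference all have the sign \<open>-1\<close>, and
  \<open>w S \<inter> w T \<inter> w (sym_diff S T) = {}\<close>.  In other words, \<open>w\<close> labels the points of the projective space of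
  dimension \<open>s - 1\<close> over the field with two elements by minimal non-simplices in such a way that the
  three labels on a line never have a common vertex (\<open>admissible_of_free_torus\<close>).

  For \<open>s \<le> 3\<close> such a labelling is also sufficient (\<open>free_torus_of_admissible\<close>).  The points whose
  labels contain a given vertex \<open>i\<close> include no line, and in projective dimension at most two this
  implies that some linear functional \<open>R i\<close> over the field with two elements has the value \<open>1\<close> at all of them.
  Reading the coefficients of \<open>R i\<close> as integers \<open>0\<close> and \<open>1\<close> gives the exponents of a homomorphism
  \<open>T^s \<rightarrow> T^m\<close>.  Modulo two the exponent vectors outside any simplex span; a \<open>0/1\<close> matrix
  of size at most three whose determinant is odd has determinant \<open>1\<close> or \<open>-1\<close>, so they span over the integers as well,
  which is freeness.  Both directions together give \<open>buchstaber_ge_iff\<close>.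

  What remains is to read off the labellings.  A point (\<open>s = 1\<close>) needs one minimal non-simplex; a line
  (\<open>s = 2\<close>) needs three, possibly equal, without a common vertex; and for \<open>s = 3\<close> the labelled
  space is the Fano plane.  If its seven labels are distinct they are of the form (i).  Equal labels
  merge points, and every way of merging leads to one of the forms (ii)--(v)
  (\<open>has_form_of_admissible_3\<close>); conversely each form is a labelling of the Fano plane with repetitions.
\<close>

section \<open>The torus and its free actions\<close>

lemma group_circle_group: "group circle_group"
proof (rule groupI)
  show "\<exists>y\<in>carrier circle_group. y \<otimes>\<^bsub>circle_group\<^esub> x = \<one>\<^bsub>circle_group\<^esub>" if "x \<in> carrier circle_group" for x
    proof (intro bexI[of _ "inverse x"])
    have "x \<noteq> 0" "norm x = 1" using that by (auto simp: circle_group_def)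
    then show "inverse x \<otimes>\<^bsub>circle_group\<^esub> x = \<one>\<^bsub>circle_group\<^esub>"
      and "inverse x \<in> carrier circle_group"
      by (simp_all add: circle_group_def norm_inverse)
  qed
qed (auto simp: circle_group_def norm_mult)

lemma group_torus: "group (torus m)"
  by (simp add: torus_def group_circle_group)

lemma carrier_torus: "carrier (torus m) = {1..m} \<rightarrow>\<^sub>E sphere 0 1"
  by (simp add: torus_def circle_group_def)

lemma one_torus: "\<one>\<^bsub>torus m\<^esub> = (\<lambda>i\<in>{1..m}. 1)"
  by (simp add: torus_def circle_group_def)

lemma mult_torus: "x \<otimes>\<^bsub>torus m\<^esub> y = (\<lambda>i\<in>{1..m}. x i * y i)"
  by (simp add: torus_def circle_group_def)

lemma topspace_torus: "topspace (torus_topology m) = {1..m} \<rightarrow>\<^sub>E sphere 0 1"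
  by (simp add: torus_topology_def)

lemma compact_space_torus: "compact_space (torus_topology m)"
  by (simp add: torus_topology_def compact_space_product_topology compact_space_subtopology)

lemma Hausdorff_space_torus: "Hausdorff_space (torus_topology m)"
  by (simp add: torus_topology_def Hausdorff_space_product_topology Hausdorff_space_subtopology)

text \<open>
  The stabilizer of a point consists of the torus elements that are \<open>1\<close> wherever the point is not \<open>0\<close>, and
  the vanishing coordinates of points of the moment-angle complex form exactly the simplices of \<open>K\<close>.
  So freeness is a condition on the coordinate subtori of the simplices.
\<close>

lemma acts_freely_iff:
  assumes "abstract_simplicial_complex m K" and "H \<subseteq> carrier (torus m)"
  shows "acts_freely m H (moment_angle_complex m K) \<longleftrightarrow>
    (\<forall>h\<in>H. \<forall>\<sigma>\<in>K. (\<forall>i\<in>{1..m} - \<sigma>. h i = 1) \<longrightarrow> h = \<one>\<^bsub>torus m\<^esub>)"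
    (is "_ \<longleftrightarrow> ?trivial")
proof
  assume free: "acts_freely m H (moment_angle_complex m K)"
  show ?trivial
  proof (intro ballI impI)
    fix h \<sigma> assume h: "h \<in> H" and \<sigma>: "\<sigma> \<in> K" and fix1: "\<forall>i\<in>{1..m} - \<sigma>. h i = 1"
    \<comment> \<open>The point with the largest stabilizer among those whose vanishing coordinates lie in \<open>\<sigma>\<close>.\<close>
    define x :: "nat \<Rightarrow> complex" where "x = (\<lambda>i\<in>{1..m}. if i \<in> \<sigma> then 0 else 1)"
    have "\<sigma> \<subseteq> {1..m}"
      using assms(1) \<sigma> unfolding abstract_simplicial_complex_def by blast
    then have "{i \<in> {1..m}. x i \<notin> sphere 0 1} = \<sigma>"
      unfolding x_def by auto
    then have "x \<in> moment_angle_complex m K"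
      using \<sigma> by (auto simp: moment_angle_complex_def x_def)
    moreover have "torus_act m h x = x"
      using fix1 by (auto simp: torus_act_def x_def)
    ultimately show "h = \<one>\<^bsub>torus m\<^esub>"
      using free h by (auto simp: acts_freely_def)
  qed
next
  assume triv: ?trivial
  show "acts_freely m H (moment_angle_complex m K)"
    unfolding acts_freely_def
  proof (intro ballI impI)
    fix h x assume h: "h \<in> H" and x: "x \<in> moment_angle_complex m K" and eq: "torus_act m h x = x"
    have "h i = 1" if "i \<in> {1..m}" "x i \<in> sphere 0 1" for i
    proof -
      have "h i * x i = x i" using fun_cong[OF eq, of i] that(1) by (simp add: torus_act_def)
      moreover have "x i \<noteq> 0" using that(2) by auto
      ultimately show ?thesis by simp
    qed
    then have "\<forall>i\<in>{1..m} - {i \<in> {1..m}. x i \<notin> sphere 0 1}. h i = 1" by blast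
    moreover have "{i \<in> {1..m}. x i \<notin> sphere 0 1} \<in> K"
      using x by (simp add: moment_angle_complex_def)
    ultimately show "h = \<one>\<^bsub>torus m\<^esub>" using triv h by blast
  qed
qed

section \<open>Involutions of a free torus\<close>

text \<open>
  The nonempty subsets of \<open>{1..s}\<close> are the points of a projective space over the field with two
  elements, addition being the symmetric difference; \<open>S\<close>, \<open>T\<close>, \<open>sym_diff S T\<close> are the points of a line.
\<close>

definition admissible :: "nat \<Rightarrow> nat set set \<Rightarrow> (nat set \<Rightarrow> nat set) \<Rightarrow> bool" where
  "admissible s N w \<longleftrightarrow>
     (\<forall>S. S \<subseteq> {1..s} \<and> S \<noteq> {} \<longrightarrow> w S \<in> N) \<and>
     (\<forall>S T. S \<subseteq> {1..s} \<and> S \<noteq> {} \<and> T \<subseteq> {1..s} \<and> T \<noteq> {} \<and> S \<noteq> T \<longrightarrow>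
        w S \<inter> w T \<inter> w (sym_diff S T) = {})"

lemma admissible_mem:
  "admissible s N w \<Longrightarrow> S \<subseteq> {1..s} \<Longrightarrow> S \<noteq> {} \<Longrightarrow> w S \<in> N"
  by (simp add: admissible_def)

lemma admissible_line:
  assumes "admissible s N w" "S \<subseteq> {1..s}" "S \<noteq> {}" "T \<subseteq> {1..s}" "T \<noteq> {}" "S \<noteq> T"
    and "sym_diff S T = U"
  shows "w S \<inter> w T \<inter> w U = {}"
proof -
  have "\<forall>S T. S \<subseteq> {1..s} \<and> S \<noteq> {} \<and> T \<subseteq> {1..s} \<and> T \<noteq> {} \<and> S \<noteq> T \<longrightarrow>
      w S \<inter> w T \<inter> w (sym_diff S T) = {}"
    using assms(1) unfolding admissible_def by (rule conjunct2)
  from mp[OF spec[OF spec[OF this]], of S T] show ?thesis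
    using assms(2-6) unfolding assms(7)[symmetric] by simp
qed

lemma contains_min_nonsimplex:
  assumes "\<omega> \<subseteq> {1..m}" and "\<omega> \<notin> K"
  shows "\<exists>\<tau>\<in>min_nonsimplices m K. \<tau> \<subseteq> \<omega>"
proof -
  have "finite \<omega>" using assms(1) finite_subset by blast
  then show ?thesis using assms
  proof (induction \<omega> rule: finite_psubset_induct)
    case (psubset \<omega>)
    show ?case
    proof (cases "\<forall>\<tau>. \<tau> \<subset> \<omega> \<longrightarrow> \<tau> \<in> K")
      case True
      with psubset.prems show ?thesis by (auto simp: min_nonsimplices_def)
    next
      case False
      then obtain \<tau> where \<tau>: "\<tau> \<subset> \<omega>" "\<tau> \<notin> K" by blast
      then have "\<exists>\<rho>\<in>min_nonsimplices m K. \<rho> \<subseteq> \<tau>"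
        using psubset.prems by (intro psubset.IH) auto
      then show ?thesis using \<tau>(1) by blast
    qed
  qed
qed

definition free_torus :: "nat \<Rightarrow> nat set set \<Rightarrow> nat \<Rightarrow> bool" where
  "free_torus m K s \<longleftrightarrow>
     (\<exists>H. toric_subgroup m s H \<and> acts_freely m H (moment_angle_complex m K))"

text \<open>
  \<open>\<Omega> S\<close> is the set of positions of the signs \<open>-1\<close> in the image of the involution with entries \<open>-1\<close> on \<open>S\<close>.
  The image of an involution is its own inverse, hence a vector of signs.
\<close>

lemma involutions_of_free_torus:
  assumes K: "abstract_simplicial_complex m K" and "free_torus m K s"
  obtains \<Omega> where "\<And>S. \<Omega> S \<subseteq> {1..m}"
    and "\<And>S. S \<subseteq> {1..s} \<Longrightarrow> S \<noteq> {} \<Longrightarrow> \<Omega> S \<notin> K"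
    and "\<And>S T. \<Omega> (sym_diff S T) = sym_diff (\<Omega> S) (\<Omega> T)"
proof -
  obtain H f where H: "subgroup H (torus m)"
    and f: "f \<in> iso (torus s) (torus m\<lparr>carrier := H\<rparr>)"
    and free: "acts_freely m H (moment_angle_complex m K)"
    using assms(2) by (auto simp: free_torus_def toric_subgroup_def)
  have H_sub: "H \<subseteq> carrier (torus m)" using H by (simp add: subgroup.subset)
  define e :: "nat set \<Rightarrow> nat \<Rightarrow> complex"
    where "e = (\<lambda>S. \<lambda>j\<in>{1..s}. if j \<in> S then - 1 else 1)"
  have e_carrier: "e S \<in> carrier (torus s)" for S
    by (auto simp: e_def carrier_torus)
  have e_mult: "e S \<otimes>\<^bsub>torus s\<^esub> e T = e (sym_diff S T)" for S T
    by (auto simp: e_def mult_torus)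
  have f_mem: "f (e S) \<in> H" for S
    using f e_carrier by (auto simp: iso_iff)
  have f_mult: "f (e (sym_diff S T)) = (\<lambda>i\<in>{1..m}. f (e S) i * f (e T) i)" for S T
  proof -
    have "f (e S \<otimes>\<^bsub>torus s\<^esub> e T) = f (e S) \<otimes>\<^bsub>torus m\<^esub> f (e T)"
      using f e_carrier by (auto simp: iso_def hom_def)
    then show ?thesis unfolding e_mult by (simp only: mult_torus)
  qed
  have f_nz: "f (e S) i \<noteq> 0" if "i \<in> {1..m}" for S i
  proof -
    have "f (e S) \<in> {1..m} \<rightarrow>\<^sub>E sphere 0 1" using f_mem H_sub carrier_torus by blast
    then have "f (e S) i \<in> sphere 0 1" using that by (rule PiE_mem)
    then show ?thesis by auto
  qed
  have f_empty: "f (e {}) i = 1" if "i \<in> {1..m}" for i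
    using fun_cong[OF f_mult[of "{}" "{}"], of i] that f_nz[OF that, of "{}"] by simp
  have f_sign: "f (e S) i = 1 \<or> f (e S) i = - 1" if "i \<in> {1..m}" for S i
    using fun_cong[OF f_mult[of S S], of i] that f_empty[OF that] by (simp add: square_eq_1_iff)
  define \<Omega> where "\<Omega> = (\<lambda>S. {i \<in> {1..m}. f (e S) i = - 1})"
  show thesis
  proof (rule that[of \<Omega>])
    show "\<Omega> S \<subseteq> {1..m}" for S by (auto simp: \<Omega>_def)
  next
    fix S assume S: "S \<subseteq> {1..s}" "S \<noteq> {}"
    show "\<Omega> S \<notin> K"
    proof
      assume "\<Omega> S \<in> K"
      moreover have "\<forall>i\<in>{1..m} - \<Omega> S. f (e S) i = 1" using f_sign unfolding \<Omega>_def by blast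
      ultimately have "f (e S) = \<one>\<^bsub>torus m\<^esub>"
        using free f_mem unfolding acts_freely_iff[OF K H_sub] by blast
      moreover have "f (e {}) = \<one>\<^bsub>torus m\<^esub>"
      proof -
        have "f (e {}) \<in> extensional {1..m}"
          using f_mem[of "{}"] H_sub carrier_torus by (auto simp: PiE_def)
        then show ?thesis unfolding one_torus
          using f_empty by (intro extensionalityI[of _ "{1..m}"]) auto
      qed
      moreover have "inj_on f (carrier (torus s))" using f by (auto simp: iso_iff)
      ultimately have "e S = e {}" using e_carrier by (metis inj_onD)
      moreover obtain j where "j \<in> S" using S(2) by blast
      moreover have "j \<in> {1..s}" using S(1) \<open>j \<in> S\<close> by blast
      ultimately have "e S j = e {} j" "j \<in> S" "j \<in> {1..s}" by simp_all
      then show False by (simp add: e_def)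
    qed
  next
    fix S T
    have "f (e (sym_diff S T)) i = - 1 \<longleftrightarrow> (f (e S) i = - 1) \<noteq> (f (e T) i = - 1)"
      if "i \<in> {1..m}" for i
      using f_sign[OF that, of S] f_sign[OF that, of T] fun_cong[OF f_mult[of S T], of i] that
      by auto
    then show "\<Omega> (sym_diff S T) = sym_diff (\<Omega> S) (\<Omega> T)"
      unfolding \<Omega>_def by blast
  qed
qed

lemma admissible_of_free_torus:
  assumes K: "abstract_simplicial_complex m K" and "free_torus m K s" "r \<le> s"
  shows "\<exists>w. admissible r (min_nonsimplices m K) w"
proof -
  obtain \<Omega> where sub: "\<And>S. \<Omega> S \<subseteq> {1..m}"
    and non: "\<And>S. S \<subseteq> {1..s} \<Longrightarrow> S \<noteq> {} \<Longrightarrow> \<Omega> S \<notin> K"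
    and add: "\<And>S T. \<Omega> (sym_diff S T) = sym_diff (\<Omega> S) (\<Omega> T)"
    using involutions_of_free_torus[OF assms(1,2)] by metis
  define w where "w S = (SOME \<tau>. \<tau> \<in> min_nonsimplices m K \<and> \<tau> \<subseteq> \<Omega> S)" for S
  have w: "w S \<in> min_nonsimplices m K \<and> w S \<subseteq> \<Omega> S" if "S \<subseteq> {1..r}" "S \<noteq> {}" for S
  proof -
    have "S \<subseteq> {1..s}" using that(1) assms(3) by fastforce
    then have "\<exists>\<tau>. \<tau> \<in> min_nonsimplices m K \<and> \<tau> \<subseteq> \<Omega> S"
      using contains_min_nonsimplex[OF sub non, of S] that(2) by blast
    then show ?thesis unfolding w_def by (rule someI_ex)
  qed
  have "w S \<inter> w T \<inter> w (sym_diff S T) = {}"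
    if "S \<subseteq> {1..r}" "S \<noteq> {}" "T \<subseteq> {1..r}" "T \<noteq> {}" "S \<noteq> T" for S T
  proof -
    have "w S \<subseteq> \<Omega> S" "w T \<subseteq> \<Omega> T" using w that by auto
    moreover have "w (sym_diff S T) \<subseteq> \<Omega> (sym_diff S T)"
      using that by (intro w[THEN conjunct2]) auto
    ultimately show ?thesis unfolding add by blast
  qed
  then have "admissible r (min_nonsimplices m K) w"
    unfolding admissible_def using w by simp
  then show ?thesis by blast
qed

text \<open>
  Distinct involutions of the \<open>s\<close>-torus have distinct sign patterns, which bounds \<open>2 ^ s\<close> by \<open>2 ^ m\<close>.
  It makes the set of dimensions in the Buchstaber invariant finite, so that its maximum is attained.
\<close>

lemma free_torus_dim_le:
  assumes K: "abstract_simplicial_complex m K" and "free_torus m K s"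
  shows "s \<le> m"
proof -
  obtain \<Omega> where sub: "\<And>S. \<Omega> S \<subseteq> {1..m}"
    and non: "\<And>S. S \<subseteq> {1..s} \<Longrightarrow> S \<noteq> {} \<Longrightarrow> \<Omega> S \<notin> K"
    and add: "\<And>S T. \<Omega> (sym_diff S T) = sym_diff (\<Omega> S) (\<Omega> T)"
    using involutions_of_free_torus[OF assms] by metis
  have "{} \<in> K" using K by (auto simp: abstract_simplicial_complex_def)
  have "inj_on \<Omega> (Pow {1..s})"
  proof (rule inj_onI)
    fix S T assume ST: "S \<in> Pow {1..s}" "T \<in> Pow {1..s}" "\<Omega> S = \<Omega> T"
    then have "\<Omega> (sym_diff S T) \<in> K" using add \<open>{} \<in> K\<close> by simp
    then have "sym_diff S T = {}" using non[of "sym_diff S T"] ST(1,2) by blast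
    then show "S = T" by blast
  qed
  then have "card (Pow {1..s}) \<le> card (Pow {1..m})"
    using sub by (intro card_inj_on_le[of \<Omega>]) auto
  then show ?thesis by (simp add: card_Pow)
qed

section \<open>Tori given by exponents zero and one\<close>

text \<open>
  The set \<open>R i\<close> is row \<open>i\<close> of a \<open>0/1\<close> matrix of exponents.  The spanning condition for \<open>\<sigma>\<close> says that the
  image meets the coordinate torus of \<open>\<sigma>\<close> trivially; its case \<open>\<sigma> = {}\<close> makes the homomorphism
  injective, and by compactness it is then a homeomorphism onto a closed subgroup.
\<close>

lemma free_torus_of_exponents:
  assumes K: "abstract_simplicial_complex m K"
    and R: "\<And>i. R i \<subseteq> {1..s}"
    and spanning: "\<And>t \<sigma>. t \<in> {1..s} \<rightarrow>\<^sub>E sphere 0 1 \<Longrightarrow> \<sigma> \<in> K \<Longrightarrow>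
           \<forall>i\<in>{1..m} - \<sigma>. (\<Prod>j\<in>R i. t j) = (1::complex) \<Longrightarrow> \<forall>j\<in>{1..s}. t j = 1"
  shows "free_torus m K s"
proof -
  define f :: "(nat \<Rightarrow> complex) \<Rightarrow> nat \<Rightarrow> complex"
    where "f t = (\<lambda>i\<in>{1..m}. \<Prod>j\<in>R i. t j)" for t
  define H where "H = f ` carrier (torus s)"
  have empty: "{} \<in> K" using K by (auto simp: abstract_simplicial_complex_def)
  have f_carrier: "f t \<in> carrier (torus m)" if "t \<in> carrier (torus s)" for t
  proof -
    have "norm (\<Prod>j\<in>R i. t j) = 1" for i
      using that R[of i] unfolding prod_norm[symmetric]
      by (intro prod.neutral) (fastforce simp: carrier_torus PiE_iff)
    then show ?thesis by (auto simp: f_def carrier_torus)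
  qed
  have f_mult: "f (x \<otimes>\<^bsub>torus s\<^esub> y) = f x \<otimes>\<^bsub>torus m\<^esub> f y" for x y
  proof -
    have "(\<Prod>j\<in>R i. (\<lambda>j\<in>{1..s}. x j * y j) j) = (\<Prod>j\<in>R i. x j) * (\<Prod>j\<in>R i. y j)" for i
      unfolding prod.distrib[symmetric] using R[of i] by (intro prod.cong) auto
    then show ?thesis unfolding f_def mult_torus by (intro restrict_ext) auto
  qed
  interpret f: group_hom "torus s" "torus m" f
    using f_carrier f_mult
    by (intro group_hom.intro group_hom_axioms.intro group_torus) (auto simp: hom_def)
  have trivial: "t = \<one>\<^bsub>torus s\<^esub>"
    if t: "t \<in> carrier (torus s)" and "\<sigma> \<in> K" "\<forall>i\<in>{1..m} - \<sigma>. f t i = 1" for t \<sigma>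
  proof -
    have tP: "t \<in> {1..s} \<rightarrow>\<^sub>E sphere 0 1" using t by (simp add: carrier_torus)
    then have "\<forall>j\<in>{1..s}. t j = 1" using spanning[OF tP that(2)] that(3) by (simp add: f_def)
    then show ?thesis unfolding one_torus using tP
      by (intro extensionalityI[of _ "{1..s}"]) (auto simp: PiE_def)
  qed
  have inj: "inj_on f (carrier (torus s))"
  proof -
    have "t = \<one>\<^bsub>torus s\<^esub>" if "t \<in> carrier (torus s)" "f t = \<one>\<^bsub>torus m\<^esub>" for t
      using that by (intro trivial[OF _ empty]) (auto simp: one_torus)
    then show ?thesis
      unfolding f.inj_iff_trivial_ker kernel_def using f.hom_one f.one_closed by blast
  qed
  have sub: "subgroup H (torus m)"
    unfolding H_def by (rule f.img_is_subgroup)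
  have cont: "continuous_map (torus_topology s) (torus_topology m) f"
  proof -
    have "continuous_map (torus_topology s) euclidean (\<lambda>t. \<Prod>j\<in>R i. t j)" for i
    proof -
      have "continuous_map (torus_topology s) euclidean (\<lambda>t. t j)" if "j \<in> R i" for j
        using that R[of i] continuous_map_product_projection[of j "{1..s}" "\<lambda>_. top_of_set (sphere 0 1)"]
        by (auto simp: torus_topology_def continuous_map_in_subtopology)
      then show ?thesis
        by (simp add: continuous_map_atin tendsto_prod)
    qed
    moreover have "f t i \<in> sphere 0 1" if "t \<in> topspace (torus_topology s)" "i \<in> {1..m}" for t i
      using f_carrier[of t] that by (auto simp: topspace_torus carrier_torus PiE_iff)
    ultimately show ?thesis
      unfolding torus_topology_def[of m]
      by (auto simp: continuous_map_componentwise continuous_map_in_subtopology f_def)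
  qed
  have topcarrier: "topspace (torus_topology s) = carrier (torus s)"
    by (simp add: topspace_torus carrier_torus)
  have "homeomorphic_map (torus_topology s) (subtopology (torus_topology m) H) f"
    using continuous_imp_embedding_map[OF cont compact_space_torus Hausdorff_space_torus] inj
    by (simp add: embedding_map_def topcarrier H_def)
  moreover have "closedin (torus_topology m) H"
    using image_compactin[OF _ cont, of "topspace (torus_topology s)"] compact_space_torus[of s]
    by (intro compactin_imp_closedin[OF Hausdorff_space_torus])
       (simp add: compact_space_def topcarrier H_def)
  moreover have "f \<in> iso (torus s) (torus m\<lparr>carrier := H\<rparr>)"
    using inj f_mult by (auto simp: iso_def hom_def H_def bij_betw_def)
  ultimately have "toric_subgroup m s H"
    using sub unfolding toric_subgroup_def by blast
  moreover have "acts_freely m H (moment_angle_complex m K)"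
    unfolding acts_freely_iff[OF K subgroup.subset[OF sub]]
    unfolding H_def using trivial f.hom_one by blast
  ultimately show ?thesis unfolding free_torus_def by blast
qed

section \<open>Dimension at most three: from labellings to free tori\<close>

lemma subset_3_iff:
  "A \<subseteq> {1..3::nat} \<longleftrightarrow> A \<in> {{}, {1}, {2}, {3}, {1,2}, {1,3}, {2,3}, {1,2,3}}"
proof -
  have "{1..3::nat} = {1,2,3}" by auto
  moreover have "Pow {1,2,3::nat} = {{}, {1}, {2}, {3}, {1,2}, {1,3}, {2,3}, {1,2,3}}"
    by (simp add: Pow_insert insert_commute)
  ultimately show ?thesis by (metis Pow_iff)
qed

text \<open>
  Every set of points of the Fano plane that meets all lines contains a line.  The complement of a set
  without a full line is such a set, so the set avoids some line, and the linear form that vanishes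
  on that line is \<open>1\<close> on the set.  Here \<open>p12\<close> stands for the membership of the sum of the first two
  basis points, and so on; \<open>x\<close>, \<open>y\<close>, \<open>z\<close> are the coefficients of the linear form.
\<close>

lemma affine_system_solvable:
  assumes "\<not> (p1 \<and> p2 \<and> p12)" "\<not> (p1 \<and> p3 \<and> p13)" "\<not> (p1 \<and> p23 \<and> p123)"
    "\<not> (p2 \<and> p3 \<and> p23)" "\<not> (p2 \<and> p13 \<and> p123)" "\<not> (p12 \<and> p3 \<and> p123)"
    "\<not> (p12 \<and> p13 \<and> p23)"
  shows "\<exists>x y z. (p1 \<longrightarrow> x) \<and> (p2 \<longrightarrow> y) \<and> (p3 \<longrightarrow> z) \<and> (p12 \<longrightarrow> x \<noteq> y) \<and>
    (p13 \<longrightarrow> x \<noteq> z) \<and> (p23 \<longrightarrow> y \<noteq> z) \<and> (p123 \<longrightarrow> (x \<longleftrightarrow> (y \<longleftrightarrow> z)))"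
  using assms
  by (cases p1; cases p2; cases p3; cases p12; cases p13; cases p23; cases p123)
    (simp_all add: ex_bool_eq)

text \<open>
  The parity of \<open>card (S \<inter> R)\<close> is the value at \<open>S\<close> of the linear form with coefficient vector \<open>R\<close>.
\<close>

lemma odd_system_solvable:
  fixes P :: "nat set \<Rightarrow> bool"
  assumes no_line: "\<And>S T. S \<subseteq> {1..3} \<Longrightarrow> S \<noteq> {} \<Longrightarrow> T \<subseteq> {1..3} \<Longrightarrow> T \<noteq> {} \<Longrightarrow> S \<noteq> T \<Longrightarrow>
      \<not> (P S \<and> P T \<and> P (sym_diff S T))"
  shows "\<exists>R. \<forall>S. S \<subseteq> {1..3} \<and> S \<noteq> {} \<and> P S \<longrightarrow> odd (card (S \<inter> R))"
proof -
  have lines: "\<not> (P {1} \<and> P {2} \<and> P {1,2})" "\<not> (P {1} \<and> P {3} \<and> P {1,3})"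
    "\<not> (P {1} \<and> P {2,3} \<and> P {1,2,3})" "\<not> (P {2} \<and> P {3} \<and> P {2,3})"
    "\<not> (P {2} \<and> P {1,3} \<and> P {1,2,3})" "\<not> (P {1,2} \<and> P {3} \<and> P {1,2,3})"
    "\<not> (P {1,2} \<and> P {1,3} \<and> P {2,3})"
    using no_line[of "{1}" "{2}"] no_line[of "{1}" "{3}"] no_line[of "{2,3}" "{1}"]
      no_line[of "{2}" "{3}"] no_line[of "{1,3}" "{2}"] no_line[of "{1,2}" "{3}"]
      no_line[of "{1,2}" "{1,3}"]
    by (auto simp: insert_Diff_if insert_commute doubleton_eq_iff)
  obtain x y z where xyz: "P {1} \<longrightarrow> x" "P {2} \<longrightarrow> y" "P {3} \<longrightarrow> z"
    "P {1,2} \<longrightarrow> x \<noteq> y" "P {1,3} \<longrightarrow> x \<noteq> z" "P {2,3} \<longrightarrow> y \<noteq> z" "P {1,2,3} \<longrightarrow> (x \<longleftrightarrow> (y \<longleftrightarrow> z))"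
    using affine_system_solvable[OF lines] by (elim exE conjE) (rule that)
  define R :: "nat set" where "R = {j. j = 1 \<and> x \<or> j = 2 \<and> y \<or> j = 3 \<and> z}"
  have R: "\<forall>S\<in>{{1}, {2}, {3}, {1,2}, {1,3}, {2,3}, {1,2,3}}. P S \<longrightarrow> odd (card (S \<inter> R))"
    using xyz by (cases x; cases y; cases z) (simp_all add: R_def Int_insert_left)
  have "odd (card (S \<inter> R))" if "S \<subseteq> {1..3}" "S \<noteq> {}" "P S" for S
  proof -
    have "S \<in> {{1}, {2}, {3}, {1,2}, {1,3}, {2,3}, {1,2,3}}"
      using that(1,2) unfolding subset_3_iff by simp
    from bspec[OF R this] that(3) show ?thesis by (rule mp)
  qed
  then show ?thesis by (intro exI[of _ R]) simp
qed

text \<open>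
  The hypothesis says that the exponent vectors \<open>A\<close> of monomials with value \<open>1\<close> at \<open>t\<close> lie in
  no hyperplane modulo two, so three of them have an odd determinant.  As a \<open>0/1\<close> determinant
  of size three is at most \<open>2\<close> in absolute value, it is \<open>1\<close> or \<open>-1\<close> and \<open>t\<close> is trivial.  Solving
  for the coordinates one after another replaces the determinant: the hyperplanes yield one coordinate
  equal to \<open>1\<close>, and then the problem has two unknowns.
\<close>

lemma zero_one_lift_unimodular:
  fixes t :: "nat \<Rightarrow> 'a::field"
  assumes "\<And>S. S \<subseteq> {1..3} \<Longrightarrow> S \<noteq> {} \<Longrightarrow>
      \<exists>A. A \<subseteq> {1..3} \<and> odd (card (S \<inter> A)) \<and> (\<Prod>j\<in>A. t j) = 1"
  shows "\<forall>j\<in>{1..3}. t j = 1"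
proof -
  let ?x = "t 1" and ?y = "t 2" and ?z = "t 3"
  have hit: "\<exists>A\<in>{{}, {1}, {2}, {3}, {1,2}, {1,3}, {2,3}, {1,2,3}}.
      odd (card (S \<inter> A)) \<and> (\<Prod>j\<in>A. t j) = 1"
    if "S \<in> {{1}, {2}, {3}, {1,2}, {1,3}, {2,3}, {1,2,3}}" for S
  proof -
    have "S \<subseteq> {1..3}" "S \<noteq> {}" using that by auto
    from assms[OF this] show ?thesis unfolding subset_3_iff by (simp only: Bex_def) 
  qed
  have h1: "?x = 1 \<or> ?x * ?y = 1 \<or> ?x * ?z = 1 \<or> ?x * (?y * ?z) = 1"
    using hit[of "{1}"] by (simp add: Int_insert_left)
  have h2: "?y = 1 \<or> ?x * ?y = 1 \<or> ?y * ?z = 1 \<or> ?x * (?y * ?z) = 1"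
    using hit[of "{2}"] by (simp add: Int_insert_left)
  have h3: "?z = 1 \<or> ?x * ?z = 1 \<or> ?y * ?z = 1 \<or> ?x * (?y * ?z) = 1"
    using hit[of "{3}"] by (simp add: Int_insert_left)
  have h12: "?x = 1 \<or> ?y = 1 \<or> ?x * ?z = 1 \<or> ?y * ?z = 1"
    using hit[of "{1,2}"] by (simp add: Int_insert_left)
  have h13: "?x = 1 \<or> ?z = 1 \<or> ?x * ?y = 1 \<or> ?y * ?z = 1"
    using hit[of "{1,3}"] by (simp add: Int_insert_left)
  have h23: "?y = 1 \<or> ?z = 1 \<or> ?x * ?y = 1 \<or> ?x * ?z = 1"
    using hit[of "{2,3}"] by (simp add: Int_insert_left)
  have h123: "?x = 1 \<or> ?y = 1 \<or> ?z = 1 \<or> ?x * (?y * ?z) = 1"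
    using hit[of "{1,2,3}"] by (simp add: Int_insert_left)
  have "?x = 1 \<or> ?y = 1 \<or> ?z = 1"
  proof (rule ccontr)
    assume *: "\<not> ?thesis"
    then have xyz: "?x * (?y * ?z) = 1" using h123 by blast
    have "?x * ?z = 1 \<or> ?y * ?z = 1" using * h12 by blast
    then show False using xyz * by (metis mult.left_commute mult.right_neutral)
  qed
  then have "?x = 1 \<and> ?y = 1 \<and> ?z = 1"
  proof (elim disjE)
    assume x: "?x = 1"
    have "?y = 1 \<or> ?y * ?z = 1" "?z = 1 \<or> ?y * ?z = 1" "?y = 1 \<or> ?z = 1"
      using h2 h3 h23 x by simp_all blast+
    then show ?thesis using x by auto
  next
    assume y: "?y = 1"
    have "?x = 1 \<or> ?x * ?z = 1" "?z = 1 \<or> ?x * ?z = 1" "?x = 1 \<or> ?z = 1"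
      using h1 h3 h13 y by simp_all blast+
    then show ?thesis using y by auto
  next
    assume z: "?z = 1"
    have "?x = 1 \<or> ?x * ?y = 1" "?y = 1 \<or> ?x * ?y = 1" "?x = 1 \<or> ?y = 1"
      using h1 h2 h12 z by simp_all blast+
    then show ?thesis using z by auto
  qed
  moreover have "{1..3::nat} = {1,2,3}" by auto
  ultimately show ?thesis by simp
qed

text \<open>
  Dimensions below three are embedded into dimension three: the labels of points outside the
  subspace impose no condition on \<open>R\<close>, and the torus element is continued by \<open>1\<close>.
\<close>

lemma free_torus_of_admissible:
  assumes K: "abstract_simplicial_complex m K" and s: "s \<le> 3"
    and w: "admissible s (min_nonsimplices m K) w"
  shows "free_torus m K s"
proof -
  have "\<exists>R. \<forall>S. S \<subseteq> {1..s} \<and> S \<noteq> {} \<and> i \<in> w S \<longrightarrow> odd (card (S \<inter> R))" for i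
  proof -
    have "\<exists>R. \<forall>S. S \<subseteq> {1..3} \<and> S \<noteq> {} \<and> (S \<subseteq> {1..s} \<and> i \<in> w S) \<longrightarrow> odd (card (S \<inter> R))"
      using w by (intro odd_system_solvable) (unfold admissible_def, blast)
    moreover have "{1..s} \<subseteq> {1..3}" using s by auto
    ultimately show ?thesis by (meson subset_trans)
  qed
  then obtain R' where R': "\<And>i S. S \<subseteq> {1..s} \<Longrightarrow> S \<noteq> {} \<Longrightarrow> i \<in> w S \<Longrightarrow> odd (card (S \<inter> R' i))"
    by metis
  define R where "R i = R' i \<inter> {1..s}" for i
  have odd_R: "odd (card (S \<inter> R i))" if "S \<subseteq> {1..s}" "S \<noteq> {}" "i \<in> w S" for S i
    using R'[OF that] that(1) by (simp add: R_def Int_absorb2 flip: Int_assoc) (metis Int_commute Int_left_commute Int_absorb2)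
  show ?thesis
  proof (rule free_torus_of_exponents[OF K, of R])
    show "R i \<subseteq> {1..s}" for i by (simp add: R_def)
  next
    fix t :: "nat \<Rightarrow> complex" and \<sigma>
    assume \<sigma>: "\<sigma> \<in> K" and rel: "\<forall>i\<in>{1..m} - \<sigma>. (\<Prod>j\<in>R i. t j) = 1"
    define u where "u j = (if j \<le> s then t j else 1)" for j
    have "\<forall>j\<in>{1..3}. u j = 1"
    proof (rule zero_one_lift_unimodular)
      fix S :: "nat set" assume S: "S \<subseteq> {1..3}" "S \<noteq> {}"
      show "\<exists>A. A \<subseteq> {1..3} \<and> odd (card (S \<inter> A)) \<and> (\<Prod>j\<in>A. u j) = 1"
      proof (cases "S \<subseteq> {1..s}")
        case True
        have "w S \<subseteq> {1..m}" "w S \<notin> K"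
          using w True S(2) by (auto simp: admissible_def min_nonsimplices_def)
        moreover have "\<forall>\<tau>. \<tau> \<subseteq> \<sigma> \<longrightarrow> \<tau> \<in> K"
          using K \<sigma> by (simp add: abstract_simplicial_complex_def)
        ultimately obtain i where i: "i \<in> {1..m} - \<sigma>" "i \<in> w S" by blast
        have "(\<Prod>j\<in>R i. u j) = (\<Prod>j\<in>R i. t j)"
          by (intro prod.cong) (auto simp: u_def R_def)
        moreover have "R i \<subseteq> {1..3}" using s by (auto simp: R_def)
        ultimately show ?thesis using odd_R[OF True S(2) i(2)] rel i(1) by auto
      next
        case False
        then obtain j where j: "j \<in> S" "j > s" using S(1) by fastforce
        then have "S \<inter> {j} = {j}" "u j = 1" by (auto simp: u_def)
        \<comment> \<open>A coordinate beyond \<open>s\<close> is \<open>1\<close> by the choice of \<open>u\<close>, so it is itself the required monomial.\<close>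
        then show ?thesis using S(1) j(1) by (intro exI[of _ "{j}"]) auto
      qed
    qed
    moreover have "u j = t j" "j \<in> {1..3}" if "j \<in> {1..s}" for j
      using that s by (auto simp: u_def)
    ultimately show "\<forall>j\<in>{1..s}. t j = 1" by metis
  qed
qed

text \<open>
  A free torus of dimension larger than \<open>s\<close> also yields a labelling in dimension \<open>s\<close>, by restriction to a subspace.
\<close>

lemma buchstaber_ge_iff:
  assumes K: "abstract_simplicial_complex m K" and "s \<le> 3"
  shows "s \<le> buchstaber_invariant m K \<longleftrightarrow> (\<exists>w. admissible s (min_nonsimplices m K) w)"
proof -
  let ?D = "{s. free_torus m K s}"
  have max: "buchstaber_invariant m K = Max ?D"
    by (simp add: buchstaber_invariant_def free_torus_def)
  have fin: "finite ?D"
    using free_torus_dim_le[OF K] by (auto intro: finite_subset[of _ "{..m}"])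
  have "free_torus m K 0"
    using K by (intro free_torus_of_admissible[of _ _ _ undefined]) (auto simp: admissible_def)
  then have "?D \<noteq> {}" by blast
  then show ?thesis
    unfolding max Max_ge_iff[OF fin \<open>?D \<noteq> {}\<close>]
    using admissible_of_free_torus[OF K] free_torus_of_admissible[OF K assms(2)] by blast
qed

section \<open>Labellings of a point and of a line\<close>

lemma admissible_1_iff: "(\<exists>w. admissible 1 N w) \<longleftrightarrow> N \<noteq> {}"
proof
  assume "\<exists>w. admissible 1 N w"
  then obtain w where "admissible 1 N w" by (rule exE)
  then have "w {1} \<in> N" by (rule admissible_mem) auto
  then show "N \<noteq> {}" by blast
next
  assume "N \<noteq> {}"
  then obtain \<tau> where "\<tau> \<in> N" by blast
  moreover have "S = {} \<or> S = {1}" if "S \<subseteq> {1..1::nat}" for S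
    using that by (auto simp: subset_singleton_iff)
  ultimately have "admissible 1 N (\<lambda>_. \<tau>)" unfolding admissible_def by simp metis
  then show "\<exists>w. admissible 1 N w" by blast
qed

lemma subset_2_eqI:
  "S \<subseteq> {1..2::nat} \<Longrightarrow> T \<subseteq> {1..2} \<Longrightarrow> (1 \<in> S \<longleftrightarrow> 1 \<in> T) \<Longrightarrow> (2 \<in> S \<longleftrightarrow> 2 \<in> T) \<Longrightarrow> S = T"
proof -
  have "{1..2::nat} = {1,2}" by auto
  then show "S \<subseteq> {1..2::nat} \<Longrightarrow> T \<subseteq> {1..2} \<Longrightarrow> (1 \<in> S \<longleftrightarrow> 1 \<in> T) \<Longrightarrow> (2 \<in> S \<longleftrightarrow> 2 \<in> T) \<Longrightarrow> S = T"
    by auto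
qed

lemma subset_3_eqI:
  "S \<subseteq> {1..3::nat} \<Longrightarrow> T \<subseteq> {1..3} \<Longrightarrow> (1 \<in> S \<longleftrightarrow> 1 \<in> T) \<Longrightarrow> (2 \<in> S \<longleftrightarrow> 2 \<in> T) \<Longrightarrow>
    (3 \<in> S \<longleftrightarrow> 3 \<in> T) \<Longrightarrow> S = T"
proof -
  have "{1..3::nat} = {1,2,3}" by auto
  then show "S \<subseteq> {1..3::nat} \<Longrightarrow> T \<subseteq> {1..3} \<Longrightarrow> (1 \<in> S \<longleftrightarrow> 1 \<in> T) \<Longrightarrow> (2 \<in> S \<longleftrightarrow> 2 \<in> T) \<Longrightarrow>
    (3 \<in> S \<longleftrightarrow> 3 \<in> T) \<Longrightarrow> S = T"
    by auto
qed

lemma admissible_2_iff: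
  "(\<exists>w. admissible 2 N w) \<longleftrightarrow> (\<exists>\<tau>1\<in>N. \<exists>\<tau>2\<in>N. \<exists>\<tau>3\<in>N. \<tau>1 \<inter> \<tau>2 \<inter> \<tau>3 = {})"
proof
  assume "\<exists>w. admissible 2 N w"
  then obtain w where w: "admissible 2 N w" by blast
  have "w {1} \<inter> w {2} \<inter> w {1,2} = {}"
    by (rule admissible_line[OF w]) auto
  moreover have "w {1} \<in> N" "w {2} \<in> N" "w {1,2} \<in> N"
    by (rule admissible_mem[OF w]; auto)+
  ultimately show "\<exists>\<tau>1\<in>N. \<exists>\<tau>2\<in>N. \<exists>\<tau>3\<in>N. \<tau>1 \<inter> \<tau>2 \<inter> \<tau>3 = {}" by blast
next
  assume "\<exists>\<tau>1\<in>N. \<exists>\<tau>2\<in>N. \<exists>\<tau>3\<in>N. \<tau>1 \<inter> \<tau>2 \<inter> \<tau>3 = {}"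
  then obtain \<tau>1 \<tau>2 \<tau>3 where N: "\<tau>1 \<in> N" "\<tau>2 \<in> N" "\<tau>3 \<in> N" and e: "\<tau>1 \<inter> \<tau>2 \<inter> \<tau>3 = {}" by blast
  define w :: "nat set \<Rightarrow> nat set" where
    "w S = (if 1 \<in> S then if 2 \<in> S then \<tau>3 else \<tau>1 else \<tau>2)" for S
  have "w S \<inter> w T \<inter> w (sym_diff S T) = {}"
    if "S \<subseteq> {1..2}" "S \<noteq> {}" "T \<subseteq> {1..2}" "T \<noteq> {}" "S \<noteq> T" for S T
  proof -
    have "1 \<in> S \<or> 2 \<in> S" "1 \<in> T \<or> 2 \<in> T" "(1 \<in> S) \<noteq> (1 \<in> T) \<or> (2 \<in> S) \<noteq> (2 \<in> T)"
      using subset_2_eqI[of S "{}"] subset_2_eqI[of T "{}"] subset_2_eqI[of S T] that by auto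
    then show ?thesis using e unfolding w_def by auto
  qed
  moreover have "w S \<in> N" for S using N by (simp add: w_def)
  ultimately have "admissible 2 N w" unfolding admissible_def by simp
  then show "\<exists>w. admissible 2 N w" by blast
qed

section \<open>Degenerations of the five forms\<close>

text \<open>
  The relations of each form survive when some of the sets coincide, and then they contain the relations
  of a later form.  So the relations of one form between nonempty sets always lead to some form, with
  distinct sets.  Nonemptiness enters because it keeps disjoint sets from coinciding.
\<close>

definition has_form :: "nat set set \<Rightarrow> bool" where
  "has_form N \<longleftrightarrow> (\<exists>A\<subseteq>N. form_i A \<or> form_ii A \<or> form_iii A \<or> form_iv A \<or> form_v A)"

lemma has_form_v:
  assumes "{} \<notin> N" "{\<tau>1, \<tau>2, \<tau>3} \<subseteq> N"
    and "\<tau>1 \<inter> \<tau>2 = {}" "\<tau>1 \<inter> \<tau>3 = {}" "\<tau>2 \<inter> \<tau>3 = {}"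
  shows "has_form N"
proof -
  have "form_v {\<tau>1, \<tau>2, \<tau>3}" unfolding form_v_def
    by (intro exI conjI, rule refl) (use assms in auto)
  then show ?thesis using assms(2) unfolding has_form_def by blast
qed

lemma has_form_iv:
  assumes N: "{} \<notin> N" "{\<tau>1, \<tau>2, \<tau>3, \<tau>4} \<subseteq> N"
    and e: "\<tau>1 \<inter> \<tau>2 = {}" "\<tau>1 \<inter> \<tau>3 = {}" "\<tau>1 \<inter> \<tau>4 = {}" "\<tau>2 \<inter> \<tau>3 \<inter> \<tau>4 = {}"
  shows "has_form N"
proof (cases "distinct [\<tau>1, \<tau>2, \<tau>3, \<tau>4]")
  case True
  have "form_iv {\<tau>1, \<tau>2, \<tau>3, \<tau>4}" unfolding form_iv_def
    by (intro exI conjI, rule refl, rule True) (use e in auto)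
  then show ?thesis using N(2) unfolding has_form_def by blast
next
  case False
  moreover have "\<tau>1 \<notin> {\<tau>2, \<tau>3, \<tau>4}"
    using e(1-3) N by auto
  ultimately consider "\<tau>2 = \<tau>3" | "\<tau>2 = \<tau>4" | "\<tau>3 = \<tau>4"
    by auto
  then show ?thesis
  proof cases
    case 1 show ?thesis by (rule has_form_v[of N \<tau>1 \<tau>2 \<tau>4]) (use N e 1 in auto)
  next
    case 2 show ?thesis by (rule has_form_v[of N \<tau>1 \<tau>2 \<tau>3]) (use N e 2 in auto)
  next
    case 3 show ?thesis by (rule has_form_v[of N \<tau>1 \<tau>2 \<tau>3]) (use N e 3 in auto)
  qed
qed

text \<open>
  Merging \<open>\<tau>2\<close> or \<open>\<tau>5\<close> with \<open>\<tau>3\<close> or \<open>\<tau>4\<close> shrinks a triple condition to a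
  disjoint pair, which completes \<open>\<tau>1 \<inter> \<tau>2 = \<tau>1 \<inter> \<tau>5 = {}\<close> to the form (v); the other coincidences give one
  set that is disjoint from three sets without a common vertex, the form (iv).
\<close>

lemma has_form_iii:
  assumes N: "{} \<notin> N" "{\<tau>1, \<tau>2, \<tau>3, \<tau>4, \<tau>5} \<subseteq> N"
    and e: "\<tau>1 \<inter> \<tau>2 = {}" "\<tau>1 \<inter> \<tau>5 = {}" "\<tau>1 \<inter> \<tau>3 \<inter> \<tau>4 = {}"
      "\<tau>2 \<inter> \<tau>3 \<inter> \<tau>5 = {}" "\<tau>2 \<inter> \<tau>4 \<inter> \<tau>5 = {}"
  shows "has_form N"
proof (cases "distinct [\<tau>1, \<tau>2, \<tau>3, \<tau>4, \<tau>5]")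
  case True
  have "form_iii {\<tau>1, \<tau>2, \<tau>3, \<tau>4, \<tau>5}" unfolding form_iii_def
    by (intro exI conjI, rule refl, rule True) (rule e)+
  then show ?thesis using N(2) unfolding has_form_def by blast
next
  case False
  moreover have "\<tau>1 \<noteq> \<tau>2" "\<tau>1 \<noteq> \<tau>5"
    using e(1,2) N by auto
  ultimately consider "\<tau>1 = \<tau>3" | "\<tau>1 = \<tau>4" | "\<tau>2 = \<tau>3 \<or> \<tau>2 = \<tau>4 \<or> \<tau>3 = \<tau>5 \<or> \<tau>4 = \<tau>5" | "\<tau>2 = \<tau>5" | "\<tau>3 = \<tau>4"
    by auto
  then show ?thesis
  proof cases
    case 1 show ?thesis by (rule has_form_iv[of N \<tau>1 \<tau>2 \<tau>4 \<tau>5]) (use N e 1 in auto)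
  next
    case 2 show ?thesis by (rule has_form_iv[of N \<tau>1 \<tau>2 \<tau>3 \<tau>5]) (use N e 2 in auto)
  next
    case 3 show ?thesis by (rule has_form_v[of N \<tau>1 \<tau>2 \<tau>5]) (use N e 3 in auto)
  next
    case 4 show ?thesis by (rule has_form_iv[of N \<tau>2 \<tau>1 \<tau>3 \<tau>4]) (use N e 4 in auto)
  next
    case 5 show ?thesis by (rule has_form_iv[of N \<tau>1 \<tau>2 \<tau>3 \<tau>5]) (use N e 5 in auto)
  qed
qed

text \<open>
  Here \<open>\<tau>1\<close> is a doubled point of the Fano plane.  If one of \<open>\<tau>2\<close>, \<open>\<tau>4\<close>, \<open>\<tau>5\<close>, \<open>\<tau>6\<close> equals \<open>\<tau>1\<close>, then the point is
  tripled and the form (iv) appears; every other coincidence doubles a second point, which is the form (iii).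
\<close>

lemma has_form_ii:
  assumes N: "{} \<notin> N" "{\<tau>1, \<tau>2, \<tau>3, \<tau>4, \<tau>5, \<tau>6} \<subseteq> N"
    and e: "\<tau>1 \<inter> \<tau>3 = {}" "\<tau>1 \<inter> \<tau>2 \<inter> \<tau>4 = {}" "\<tau>1 \<inter> \<tau>2 \<inter> \<tau>5 = {}"
      "\<tau>1 \<inter> \<tau>4 \<inter> \<tau>6 = {}" "\<tau>1 \<inter> \<tau>5 \<inter> \<tau>6 = {}" "\<tau>2 \<inter> \<tau>3 \<inter> \<tau>6 = {}"
      "\<tau>3 \<inter> \<tau>4 \<inter> \<tau>5 = {}"
  shows "has_form N"
proof (cases "distinct [\<tau>1, \<tau>2, \<tau>3, \<tau>4, \<tau>5, \<tau>6]")
  case True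
  have "form_ii {\<tau>1, \<tau>2, \<tau>3, \<tau>4, \<tau>5, \<tau>6}" unfolding form_ii_def
    by (intro exI conjI, rule refl, rule True) (rule e)+
  then show ?thesis using N(2) unfolding has_form_def by blast
next
  case False
  moreover have "\<tau>1 \<noteq> \<tau>3"
    using e(1) N by auto
  ultimately consider "\<tau>1 = \<tau>2" | "\<tau>1 = \<tau>4" | "\<tau>1 = \<tau>5" | "\<tau>1 = \<tau>6" | "\<tau>2 = \<tau>3" | "\<tau>2 = \<tau>4" | "\<tau>2 = \<tau>5"
    | "\<tau>2 = \<tau>6" | "\<tau>3 = \<tau>4" | "\<tau>3 = \<tau>5" | "\<tau>3 = \<tau>6" | "\<tau>4 = \<tau>5" | "\<tau>4 = \<tau>6" | "\<tau>5 = \<tau>6"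
    by auto
  then show ?thesis
  proof cases
    case 1 show ?thesis by (rule has_form_iv[of N \<tau>1 \<tau>3 \<tau>4 \<tau>5]) (use N e 1 in auto)
  next
    case 2 show ?thesis by (rule has_form_iv[of N \<tau>1 \<tau>2 \<tau>3 \<tau>6]) (use N e 2 in auto)
  next
    case 3 show ?thesis by (rule has_form_iv[of N \<tau>1 \<tau>2 \<tau>3 \<tau>6]) (use N e 3 in auto)
  next
    case 4 show ?thesis by (rule has_form_iv[of N \<tau>1 \<tau>3 \<tau>4 \<tau>5]) (use N e 4 in auto)
  next
    case 5 show ?thesis by (rule has_form_iii[of N \<tau>2 \<tau>1 \<tau>4 \<tau>5 \<tau>6]) (use N e 5 in auto)
  next
    case 6 show ?thesis by (rule has_form_iii[of N \<tau>1 \<tau>2 \<tau>5 \<tau>6 \<tau>3]) (use N e 6 in auto)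
  next
    case 7 show ?thesis by (rule has_form_iii[of N \<tau>1 \<tau>2 \<tau>4 \<tau>6 \<tau>3]) (use N e 7 in auto)
  next
    case 8 show ?thesis by (rule has_form_iii[of N \<tau>3 \<tau>1 \<tau>4 \<tau>5 \<tau>2]) (use N e 8 in auto)
  next
    case 9 show ?thesis by (rule has_form_iii[of N \<tau>3 \<tau>1 \<tau>2 \<tau>6 \<tau>5]) (use N e 9 in auto)
  next
    case 10 show ?thesis by (rule has_form_iii[of N \<tau>3 \<tau>1 \<tau>2 \<tau>6 \<tau>4]) (use N e 10 in auto)
  next
    case 11 show ?thesis by (rule has_form_iii[of N \<tau>3 \<tau>1 \<tau>4 \<tau>5 \<tau>2]) (use N e 11 in auto)
  next
    case 12 show ?thesis by (rule has_form_iii[of N \<tau>3 \<tau>1 \<tau>2 \<tau>6 \<tau>4]) (use N e 12 in auto)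
  next
    case 13 show ?thesis by (rule has_form_iii[of N \<tau>1 \<tau>3 \<tau>2 \<tau>5 \<tau>4]) (use N e 13 in auto)
  next
    case 14 show ?thesis by (rule has_form_iii[of N \<tau>1 \<tau>3 \<tau>2 \<tau>4 \<tau>5]) (use N e 14 in auto)
  qed
qed

section \<open>Labellings of the Fano plane\<close>

text \<open>
  If the points \<open>S\<close> and \<open>T\<close> have the same label, any point \<open>R\<close> off the line through them
  completes them to a coordinate system.  The six sets are then the common label, the label of the
  third point on that line, and the labels of the four points off it; they satisfy the relations of
  the form (ii), whichever pair \<open>S\<close>, \<open>T\<close> was equal.
\<close>

lemma has_form_of_admissible_3:
  assumes N: "{} \<notin> N" and w: "admissible 3 N w"
  shows "has_form N"
proof -
  let ?V = "{S. S \<subseteq> {1..3::nat} \<and> S \<noteq> {}}"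
  have mem: "w S \<in> N" if "S \<in> ?V" for S
    using admissible_mem[OF w] that by simp
  have line: "w S \<inter> w T \<inter> w U = {}" if "S \<in> ?V" "T \<in> ?V" "S \<noteq> T" "sym_diff S T = U" for S T U
    using admissible_line[OF w] that by simp
  show ?thesis
  proof (cases "inj_on w ?V")
    case True
    let ?A = "{w {1}, w {2}, w {3}, w {1,2}, w {1,3}, w {2,3}, w {1,2,3}}"
    let ?L = "[{1}, {2}, {3}, {1,2}, {1,3}, {2,3}, {1,2,3::nat}]"
    have "distinct ?L" by (simp add: set_eq_iff) presburger
    moreover have "inj_on w (set ?L)" using True by (rule inj_on_subset) auto
    ultimately have "distinct (map w ?L)" unfolding distinct_map by (rule conjI)
    then have dist: "distinct [w {1}, w {2}, w {3}, w {1,2}, w {1,3}, w {2,3}, w {1,2,3}]"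
      by (simp only: list.map)
    have "form_i ?A" unfolding form_i_def
      by (intro exI conjI, rule refl, rule dist) (rule line; auto)+
    moreover have "?A \<subseteq> N" using mem by auto
    ultimately show ?thesis unfolding has_form_def by blast
  next
    case False
    then obtain S T where S: "S \<in> ?V" and T: "T \<in> ?V" and "S \<noteq> T" and eq: "w S = w T"
      by (auto simp: inj_on_def)
    \<comment> \<open>A line has three points, so it misses one of any four points.\<close>
    have "finite {S, T, sym_diff S T}" "card {S, T, sym_diff S T} \<le> 3"
      by (auto simp: card_insert_if)
    moreover have "card {{1}, {2}, {3}, {1,2::nat}} = 4"
      by (simp add: doubleton_eq_iff card_insert_if)
    ultimately have "\<not> {{1}, {2}, {3}, {1,2}} \<subseteq> {S, T, sym_diff S T}"
      using card_mono[of "{S, T, sym_diff S T}" "{{1}, {2}, {3}, {1,2}}"] by linarith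
    then obtain R where "R \<in> {{1}, {2}, {3}, {1,2}}" and R_new: "R \<notin> {S, T, sym_diff S T}"
      by blast
    then have "R \<in> ?V" by auto
    with R_new have R: "R \<in> ?V" "R \<noteq> S" "R \<noteq> T" "R \<noteq> sym_diff S T" by simp_all
    let ?ST = "sym_diff S T" and ?SR = "sym_diff S R" and ?TR = "sym_diff T R"
    let ?STR = "sym_diff ?ST R"
    have ne: "T \<noteq> ?SR" "S \<noteq> ?TR" "?ST \<noteq> ?SR"
      using R(2-4) by blast+
    have ST: "?ST \<in> ?V" using S T \<open>S \<noteq> T\<close> by blast
    have SR: "?SR \<in> ?V" using S R(1,2) by blast
    have TR: "?TR \<in> ?V" using T R(1,3) by blast
    have "?STR \<noteq> {}" using R(4) by blast
    then have STR: "?STR \<in> ?V" using S T R(1) by blast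
    show ?thesis
    proof (rule has_form_ii[OF N, of "w S" "w R" "w ?ST" "w ?SR" "w ?TR" "w ?STR"])
      show "{w S, w R, w ?ST, w ?SR, w ?TR, w ?STR} \<subseteq> N"
        by (simp only: insert_subset empty_subsetI mem[OF S] mem[OF R(1)] mem[OF ST] mem[OF SR]
            mem[OF TR] mem[OF STR] simp_thms)
      show "w S \<inter> w ?ST = {}"
        using line[OF S T \<open>S \<noteq> T\<close> refl] unfolding eq by (simp only: Int_absorb)
      show "w S \<inter> w R \<inter> w ?SR = {}"
        by (rule line[OF S R(1) R(2)[symmetric] refl])
      show "w S \<inter> w R \<inter> w ?TR = {}" unfolding eq
        by (rule line[OF T R(1) R(3)[symmetric] refl])
      show "w S \<inter> w ?SR \<inter> w ?STR = {}" unfolding eq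
        by (rule line[OF T SR ne(1)]) blast
      show "w S \<inter> w ?TR \<inter> w ?STR = {}"
        by (rule line[OF S TR ne(2)]) blast
      show "w R \<inter> w ?ST \<inter> w ?STR = {}"
        by (rule line[OF R(1) ST R(4)]) blast
      show "w ?ST \<inter> w ?SR \<inter> w ?TR = {}"
        by (rule line[OF ST SR ne(3)]) blast
    qed
  qed
qed

text \<open>
  The seven relations are the lines of the Fano plane whose points \<open>1\<close>, \<open>2\<close>, \<open>3\<close> are a basis and whose
  points \<open>4\<close>, \<open>5\<close>, \<open>6\<close>, \<open>7\<close> are \<open>1 + 2\<close>, \<open>1 + 3\<close>, \<open>2 + 3\<close>, \<open>1 + 2 + 3\<close>.
\<close>

lemma admissible_3I:
  assumes N: "{\<tau>1, \<tau>2, \<tau>3, \<tau>4, \<tau>5, \<tau>6, \<tau>7} \<subseteq> N"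
    and e: "\<tau>1 \<inter> \<tau>2 \<inter> \<tau>4 = {}" "\<tau>1 \<inter> \<tau>3 \<inter> \<tau>5 = {}" "\<tau>1 \<inter> \<tau>6 \<inter> \<tau>7 = {}"
      "\<tau>2 \<inter> \<tau>3 \<inter> \<tau>6 = {}" "\<tau>2 \<inter> \<tau>5 \<inter> \<tau>7 = {}" "\<tau>3 \<inter> \<tau>4 \<inter> \<tau>7 = {}" "\<tau>4 \<inter> \<tau>5 \<inter> \<tau>6 = {}"
  shows "\<exists>w. admissible 3 N w"
proof -
  define w :: "nat set \<Rightarrow> nat set" where
    "w S = (if 1 \<in> S then if 2 \<in> S then if 3 \<in> S then \<tau>7 else \<tau>4
                          else if 3 \<in> S then \<tau>5 else \<tau>1
            else if 2 \<in> S then if 3 \<in> S then \<tau>6 else \<tau>2 else \<tau>3)" for S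
  have "w S \<inter> w T \<inter> w (sym_diff S T) = {}"
    if "S \<subseteq> {1..3}" "S \<noteq> {}" "T \<subseteq> {1..3}" "T \<noteq> {}" "S \<noteq> T" for S T
  proof -
    have "1 \<in> S \<or> 2 \<in> S \<or> 3 \<in> S" "1 \<in> T \<or> 2 \<in> T \<or> 3 \<in> T"
      "(1 \<in> S) \<noteq> (1 \<in> T) \<or> (2 \<in> S) \<noteq> (2 \<in> T) \<or> (3 \<in> S) \<noteq> (3 \<in> T)"
      using subset_3_eqI[of S "{}"] subset_3_eqI[of T "{}"] subset_3_eqI[of S T] that by auto
    then show ?thesis using e unfolding w_def
      by (cases "1 \<in> S"; cases "2 \<in> S"; cases "3 \<in> S"; cases "1 \<in> T"; cases "2 \<in> T"; cases "3 \<in> T")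
        (simp_all add: Int_ac)
  qed
  moreover have "w S \<in> N" for S using N by (simp add: w_def)
  ultimately have "admissible 3 N w" unfolding admissible_def by simp
  then show ?thesis by blast
qed

text \<open>
  Each form is a labelling with repetitions.  In (ii) one label is used twice, in (iii) two labels
  are used twice.  In (iv) the label \<open>\<tau>1\<close> sits at a basis and at the sum of its vectors, which leaves
  the three points of a line; (v) is the case of (iv) in which two labels of that line agree.
\<close>

lemma admissible_3_iff:
  assumes "{} \<notin> N"
  shows "(\<exists>w. admissible 3 N w) \<longleftrightarrow> has_form N"
proof
  assume "has_form N"
  then obtain A where "A \<subseteq> N"
    and "form_i A \<or> form_ii A \<or> form_iii A \<or> form_iv A \<or> form_v A"
    unfolding has_form_def by blast
  then consider "form_i A" | "form_ii A" | "form_iii A" | "form_iv A" | "form_v A" by blast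
  then have "\<exists>w. admissible 3 A w"
  proof cases
    case 1
    then show ?thesis unfolding form_i_def
    proof (elim exE conjE, goal_cases)
      case (1 \<tau>1 \<tau>2 \<tau>3 \<tau>4 \<tau>5 \<tau>6 \<tau>7)
      show ?case
        by (rule admissible_3I[of \<tau>1 \<tau>2 \<tau>3 \<tau>4 \<tau>5 \<tau>6 \<tau>7]) (use 1 in simp_all)
    qed
  next
    case 2
    then show ?thesis unfolding form_ii_def
    proof (elim exE conjE, goal_cases)
      case (1 \<tau>1 \<tau>2 \<tau>3 \<tau>4 \<tau>5 \<tau>6)
      show ?case
        by (rule admissible_3I[of \<tau>1 \<tau>1 \<tau>2 \<tau>3 \<tau>4 \<tau>5 \<tau>6]) (use 1 in blast)+
    qed
  next
    case 3
    then show ?thesis unfolding form_iii_def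
    proof (elim exE conjE, goal_cases)
      case (1 \<tau>1 \<tau>2 \<tau>3 \<tau>4 \<tau>5)
      show ?case
        by (rule admissible_3I[of \<tau>1 \<tau>2 \<tau>5 \<tau>2 \<tau>5 \<tau>3 \<tau>4]) (use 1 in blast)+
    qed
  next
    case 4
    then show ?thesis unfolding form_iv_def
    proof (elim exE conjE, goal_cases)
      case (1 \<tau>1 \<tau>2 \<tau>3 \<tau>4)
      show ?case
        by (rule admissible_3I[of \<tau>1 \<tau>1 \<tau>1 \<tau>2 \<tau>3 \<tau>4 \<tau>1]) (use 1 in blast)+
    qed
  next
    case 5
    then show ?thesis unfolding form_v_def
    proof (elim exE conjE, goal_cases)
      case (1 \<tau>1 \<tau>2 \<tau>3)
      show ?case
        by (rule admissible_3I[of \<tau>1 \<tau>1 \<tau>1 \<tau>2 \<tau>3 \<tau>3 \<tau>1]) (use 1 in blast)+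
    qed
  qed
  then show "\<exists>w. admissible 3 N w"
    using \<open>A \<subseteq> N\<close> unfolding admissible_def by (metis subsetD)
next
  assume "\<exists>w. admissible 3 N w"
  then obtain w where "admissible 3 N w" by (rule exE)
  with assms show "has_form N" by (rule has_form_of_admissible_3)
qed

section \<open>Buchstaber invariants zero, one and two\<close>

theorem corollary14:
  fixes m :: nat and K N :: "nat set set"
  assumes "abstract_simplicial_complex m K"
    and "N = min_nonsimplices m K"
  shows "((buchstaber_invariant m K = 0 \<longleftrightarrow> N = {}) \<and> (N = {} \<longleftrightarrow> K = Pow {1..m})) \<and>
         (buchstaber_invariant m K = 1 \<longleftrightarrow>
           N \<noteq> {} \<and>
           (\<forall>\<tau>1\<in>N. \<forall>\<tau>2\<in>N. \<tau>1 \<noteq> \<tau>2 \<longrightarrow> \<tau>1 \<inter> \<tau>2 \<noteq> {}) \<and>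
           (\<forall>\<tau>1\<in>N. \<forall>\<tau>2\<in>N. \<forall>\<tau>3\<in>N. distinct [\<tau>1, \<tau>2, \<tau>3] \<longrightarrow> \<tau>1 \<inter> \<tau>2 \<inter> \<tau>3 \<noteq> {})) \<and>
         (buchstaber_invariant m K = 2 \<longleftrightarrow>
           ((\<exists>\<tau>1\<in>N. \<exists>\<tau>2\<in>N. \<tau>1 \<noteq> \<tau>2 \<and> \<tau>1 \<inter> \<tau>2 = {}) \<or>
            (\<exists>\<tau>1\<in>N. \<exists>\<tau>2\<in>N. \<exists>\<tau>3\<in>N. distinct [\<tau>1, \<tau>2, \<tau>3] \<and> \<tau>1 \<inter> \<tau>2 \<inter> \<tau>3 = {})) \<and>
           \<not> (\<exists>A \<subseteq> N. form_i A \<or> form_ii A \<or> form_iii A \<or> form_iv A \<or> form_v A))"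
proof -
  let ?s = "buchstaber_invariant m K"
  let ?two = "\<exists>\<tau>1\<in>N. \<exists>\<tau>2\<in>N. \<tau>1 \<noteq> \<tau>2 \<and> \<tau>1 \<inter> \<tau>2 = {}"
  let ?three = "\<exists>\<tau>1\<in>N. \<exists>\<tau>2\<in>N. \<exists>\<tau>3\<in>N. distinct [\<tau>1, \<tau>2, \<tau>3] \<and> \<tau>1 \<inter> \<tau>2 \<inter> \<tau>3 = {}"
  have "{} \<in> K" using assms(1) by (auto simp: abstract_simplicial_complex_def)
  then have ne: "{} \<notin> N" by (simp add: assms(2) min_nonsimplices_def)
  have ge1: "1 \<le> ?s \<longleftrightarrow> N \<noteq> {}"
    using buchstaber_ge_iff[OF assms(1), of 1] admissible_1_iff assms(2) by simp
  have ge2: "2 \<le> ?s \<longleftrightarrow> ?two \<or> ?three"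
  proof -
    have "(\<exists>\<tau>1\<in>N. \<exists>\<tau>2\<in>N. \<exists>\<tau>3\<in>N. \<tau>1 \<inter> \<tau>2 \<inter> \<tau>3 = {}) \<longleftrightarrow> ?two \<or> ?three" (is "?any \<longleftrightarrow> _")
    proof
      assume ?any
      then obtain \<tau>1 \<tau>2 \<tau>3 where \<tau>: "\<tau>1 \<in> N" "\<tau>2 \<in> N" "\<tau>3 \<in> N" "\<tau>1 \<inter> \<tau>2 \<inter> \<tau>3 = {}" by blast
      consider "distinct [\<tau>1, \<tau>2, \<tau>3]" | "\<tau>1 = \<tau>2" | "\<tau>1 = \<tau>3 \<or> \<tau>2 = \<tau>3" by auto
      then show "?two \<or> ?three"
      proof cases
        case 1
        then show ?thesis using \<tau> by blast
      next
        case 2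
        then have "\<tau>1 \<inter> \<tau>3 = {}" "\<tau>1 \<noteq> \<tau>3" using \<tau> ne by auto
        then show ?thesis using \<tau>(1,3) by blast
      next
        case 3
        then have "\<tau>1 \<inter> \<tau>2 = {}" using \<tau>(4) by blast
        moreover from this have "\<tau>1 \<noteq> \<tau>2" using \<tau>(1) ne by auto
        ultimately show ?thesis using \<tau>(1,2) by blast
      qed
    next
      assume "?two \<or> ?three"
      then show ?any by (metis Int_empty_left Int_commute)
    qed
    then show ?thesis
      using buchstaber_ge_iff[OF assms(1), of 2] admissible_2_iff assms(2) by simp
  qed
  have ge3: "3 \<le> ?s \<longleftrightarrow> (\<exists>A \<subseteq> N. form_i A \<or> form_ii A \<or> form_iii A \<or> form_iv A \<or> form_v A)"
    using buchstaber_ge_iff[OF assms(1), of 3] admissible_3_iff[OF ne] assms(2)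
    by (simp add: has_form_def)
  have simplex: "N = {} \<longleftrightarrow> K = Pow {1..m}"
  proof
    assume "N = {}"
    then have "\<omega> \<in> K" if "\<omega> \<subseteq> {1..m}" for \<omega>
      using contains_min_nonsimplex[OF that] assms(2) by blast
    then show "K = Pow {1..m}" using assms(1) unfolding abstract_simplicial_complex_def by blast
  next
    assume "K = Pow {1..m}"
    then show "N = {}" by (auto simp: assms(2) min_nonsimplices_def)
  qed
  have s0: "?s = 0 \<longleftrightarrow> \<not> 1 \<le> ?s" and s1: "?s = 1 \<longleftrightarrow> 1 \<le> ?s \<and> \<not> 2 \<le> ?s"
    and s2: "?s = 2 \<longleftrightarrow> 2 \<le> ?s \<and> \<not> 3 \<le> ?s"
    by linarith+
  have two: "\<not> ?two \<longleftrightarrow> (\<forall>\<tau>1\<in>N. \<forall>\<tau>2\<in>N. \<tau>1 \<noteq> \<tau>2 \<longrightarrow> \<tau>1 \<inter> \<tau>2 \<noteq> {})"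
    by (simp only: bex_simps ball_simps de_Morgan_conj imp_conv_disj)
  have three: "\<not> ?three \<longleftrightarrow> (\<forall>\<tau>1\<in>N. \<forall>\<tau>2\<in>N. \<forall>\<tau>3\<in>N.
      distinct [\<tau>1, \<tau>2, \<tau>3] \<longrightarrow> \<tau>1 \<inter> \<tau>2 \<inter> \<tau>3 \<noteq> {})"
    by (simp only: bex_simps ball_simps de_Morgan_conj imp_conv_disj)
  show ?thesis
    unfolding s0 s1 s2 ge1 ge2 ge3 two three de_Morgan_disj not_not
    by (intro conjI refl simplex)
qed

end
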